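(* Let $f_+$ and $f_-$ be known probability mass functions on a finite set such that $\min_i f_+(i)\ge\epsilon$ and $\min_i f_-(i)\ge\epsilon$ for a constant $\epsilon>0$. Then there exist a Monte Carlo algorithm for the clustering problem with perfect oracle and side information with query complexity $O\big(\frac{k^2\log n}{\Delta(f_+,f_-)}\big)$, and a Las Vegas algorithm with expected query complexity $O\big(n+\frac{k^2\log n}{\Delta(f_+,f_-)}\big)$.
   Context: Clustering problem: the vertex set is $V=[n]$, partitioned into $k$ unknown nonempty clusters. Perfect oracle: a query is a pair $\{u,v\}$, answered $+1$ if $u,v$ are in the same cluster and $-1$ otherwise; queries may be adaptive. Side information: a symmetric matrix $W=(w_{u,v})$ whose off-diagonal entries are independent random variables with values in a finite set $\{a_1,\dots,a_q\}\subset[0,1]$, with $w_{u,v}\sim f_+$ for same-cluster pairs and $w_{u,v}\sim f_-$ otherwise. $\Delta(f_+,f_-)=D(f_+\|f_-)+D(f_-\|f_+)$ with $D(P\|Q)=\sum_x P(x)\ln\frac{P(x)}{Q(x)}$. A Monte Carlo algorithm recovers the clusters correctly with high probability; a Las Vegas algorithm always recovers them correctly. *)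

theory Defs
  imports "HOL-Probability.Probability" "HOL-Library.Disjoint_Sets"
begin

text \<open>The sum runs over the support of \<open>p\<close>, which is the convention \<open>0 ln 0 = 0\<close>. The value is only
  meaningful for distributions with finite support such that \<open>q\<close> is positive on the support of
  \<open>p\<close>.\<close>

definition KL_div :: "'a pmf \<Rightarrow> 'a pmf \<Rightarrow> real" where
  "KL_div p q = (\<Sum>x\<in>set_pmf p. pmf p x * ln (pmf p x / pmf q x))"

definition sym_div :: "'a pmf \<Rightarrow> 'a pmf \<Rightarrow> real" where
  "sym_div p q = KL_div p q + KL_div q p"

text \<open>A clustering of the vertex set \<open>{1..n}\<close> is a partition \<open>P\<close> with \<open>partition_on {1..n} P\<close>;
  its number of clusters is \<open>card P\<close>.\<close>

definition same_cluster :: "nat set set \<Rightarrow> nat \<Rightarrow> nat \<Rightarrow> bool" where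
  "same_cluster P u v \<longleftrightarrow> (\<exists>C\<in>P. u \<in> C \<and> v \<in> C)"

text \<open>The random symmetric matrix \<open>W\<close>: one independent sample for each pair \<open>u < v\<close>, copied to the
  entry \<open>(v, u)\<close>. The diagonal, and all entries outside the vertex set, are constantly 0.\<close>

definition side_info ::
  "nat \<Rightarrow> nat set set \<Rightarrow> real pmf \<Rightarrow> real pmf \<Rightarrow> (nat \<Rightarrow> nat \<Rightarrow> real) pmf" where
  "side_info n P fp fm =
     map_pmf (\<lambda>w u v. if u = v then 0 else w (min u v, max u v))
       (Pi_pmf {(u, v). u \<in> {1..n} \<and> v \<in> {1..n} \<and> u < v} 0
         (\<lambda>(u, v). if same_cluster P u v then fp else fm))"

text \<open>Deterministic adaptive query strategies: \<open>Query u v t s\<close> asks the pair \<open>{u, v}\<close> and continues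
  with \<open>t\<close> on the answer \<open>+1\<close> and with \<open>s\<close> on the answer \<open>-1\<close>.\<close>

datatype query_tree = Output "nat set set" | Query nat nat query_tree query_tree

primrec valid_queries :: "nat \<Rightarrow> query_tree \<Rightarrow> bool" where
  "valid_queries n (Output R) \<longleftrightarrow> True"
| "valid_queries n (Query u v t s) \<longleftrightarrow>
     u \<in> {1..n} \<and> v \<in> {1..n} \<and> u \<noteq> v \<and> valid_queries n t \<and> valid_queries n s"

definition oracle_answer :: "nat set set \<Rightarrow> nat \<Rightarrow> nat \<Rightarrow> int" where
  "oracle_answer P u v = (if same_cluster P u v then 1 else - 1)"

primrec result :: "nat set set \<Rightarrow> query_tree \<Rightarrow> nat set set" where
  "result P (Output R) = R"
| "result P (Query u v t s) = (if oracle_answer P u v = 1 then result P t else result P s)"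

primrec num_queries :: "nat set set \<Rightarrow> query_tree \<Rightarrow> nat" where
  "num_queries P (Output R) = 0"
| "num_queries P (Query u v t s) =
     Suc (if oracle_answer P u v = 1 then num_queries P t else num_queries P s)"

text \<open>A randomized algorithm receives the number \<open>n\<close> of vertices and the matrix \<open>W\<close>, but neither the
  clustering nor the number of clusters, and draws a query strategy at random.\<close>

type_synonym cluster_alg = "nat \<Rightarrow> (nat \<Rightarrow> nat \<Rightarrow> real) \<Rightarrow> query_tree pmf"

definition query_alg :: "cluster_alg \<Rightarrow> bool" where
  "query_alg A \<longleftrightarrow> (\<forall>n W. \<forall>t\<in>set_pmf (A n W). valid_queries n t)"

text \<open>The strategy executed on clustering \<open>P\<close>, over the joint randomness of \<open>W\<close> and of the
  algorithm.\<close>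

definition execution ::
  "cluster_alg \<Rightarrow> real pmf \<Rightarrow> real pmf \<Rightarrow> nat \<Rightarrow> nat set set \<Rightarrow> query_tree pmf" where
  "execution A fp fm n P = bind_pmf (side_info n P fp fm) (A n)"

text \<open>``With high probability'' means failure probability at most \<open>n\<close> to the power \<open>-d\<close>.\<close>

definition monte_carlo :: "real \<Rightarrow> real pmf \<Rightarrow> real pmf \<Rightarrow> cluster_alg \<Rightarrow> bool" where
  "monte_carlo d fp fm A \<longleftrightarrow> query_alg A \<and>
     (\<forall>n\<ge>1. \<forall>P. partition_on {1..n} P \<longrightarrow>
        measure_pmf.prob (execution A fp fm n P) {t. result P t = P} \<ge> 1 - real n powr (- d))"

definition las_vegas :: "real pmf \<Rightarrow> real pmf \<Rightarrow> cluster_alg \<Rightarrow> bool" where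
  "las_vegas fp fm A \<longleftrightarrow> query_alg A \<and>
     (\<forall>n\<ge>1. \<forall>P. partition_on {1..n} P \<longrightarrow>
        (\<forall>t\<in>set_pmf (execution A fp fm n P). result P t = P))"

end

theory Submission
  imports Defs
begin

text \<open>
  The vertices are clustered online, in the order \<open>1, \<dots>, n\<close>. Once a cluster has \<open>M\<close> members, its first
  \<open>M\<close> members form a core, and every later vertex \<open>v\<close> is compared with the core by the likelihood
  ratio test on the entries of \<open>W\<close> between \<open>v\<close> and the core. Only a vertex that passes no test is
  queried against one representative of each known cluster; if no test ever errs, this happens only
  for the at most \<open>k M\<close> vertices that end up in a core, at a cost of at most \<open>k\<close> queries each.

  As long as no test has erred, the cores are the first \<open>M\<close> members of the true clusters and do not
  depend on \<open>W\<close>. Hence a union bound over the fixed family of pairs (vertex, cluster) suffices, in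
  spite of the adaptivity. By the Chernoff bound with exponent 1/2, a single test errs with probability
  at most the \<open>M\<close>-th power of the Bhattacharyya coefficient of \<open>f\<^sub>+\<close> and \<open>f\<^sub>-\<close>, which is at most
  \<open>exp (- \<epsilon> \<Delta> / 8)\<close>, so \<open>M\<close> of order \<open>ln n / \<Delta>\<close> is enough.

  The Monte Carlo version trusts the tests and gives up when a query leads into a full cluster, which
  exposes an error and keeps the query bound valid for every \<open>W\<close>. The Las Vegas version confirms every
  passed test by one query.
\<close>

subsection \<open>The online clustering strategy\<close>

text \<open>Query trees have no sequential composition, so the rest of the strategy enters as a
  continuation that is grafted onto each leaf.\<close>

primrec locate :: "nat \<Rightarrow> nat list list \<Rightarrow> (nat list option \<Rightarrow> query_tree) \<Rightarrow> query_tree" where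
  "locate v [] \<kappa> = \<kappa> None"
| "locate v (c # cs) \<kappa> = Query v (hd c) (\<kappa> (Some c)) (locate v cs \<kappa>)"

text \<open>Replacement is by value, not by position. In the states of interest the lists are
  distinct, so exactly one of them changes.\<close>

definition extend :: "nat \<Rightarrow> nat list \<Rightarrow> nat list list \<Rightarrow> nat list list" where
  "extend v c st = map (\<lambda>x. if x = c then c @ [v] else x) st"

text \<open>The flag \<open>b\<close> selects the Las Vegas version. Each list in the state \<open>st\<close> is a cluster found so
  far, in order of discovery, so that its head serves as representative and its first \<open>M\<close> entries as
  core.\<close>

primrec grow ::
  "bool \<Rightarrow> nat \<Rightarrow> (nat \<Rightarrow> nat list \<Rightarrow> bool) \<Rightarrow> nat list \<Rightarrow> nat list list \<Rightarrow> query_tree" where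
  "grow b M T [] st = Output (set ` set st)"
| "grow b M T (v # vs) st =
    (let ask = locate v st (\<lambda>r. case r of
         None \<Rightarrow> grow b M T vs ([v] # st)
       | Some c \<Rightarrow> if \<not> b \<and> M \<le> length c then Output {} else grow b M T vs (extend v c st))
     in case find (\<lambda>c. M \<le> length c \<and> T v (take M c)) st of
         None \<Rightarrow> ask
       | Some c \<Rightarrow>
           if b then Query v (hd c) (grow b M T vs (extend v c st)) ask
           else grow b M T vs (extend v c st))"

text \<open>The perfect oracle turns the chain of queries into a \<open>find\<close> over the
  representatives, the only view of \<open>locate\<close> needed for results and query
  counts.\<close>

lemma result_locate:
  "result P (locate v st \<kappa>) = result P (\<kappa> (find (\<lambda>c. same_cluster P v (hd c)) st))"
  by (induction st) (auto simp: oracle_answer_def)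

lemma num_queries_locate:
  "num_queries P (locate v st \<kappa>)
     \<le> length st + num_queries P (\<kappa> (find (\<lambda>c. same_cluster P v (hd c)) st))"
  by (induction st) (auto simp: oracle_answer_def)

lemma valid_queries_locate:
  assumes "v \<in> {1..n}" "\<And>c. c \<in> set st \<Longrightarrow> hd c \<in> {1..n} \<and> hd c \<noteq> v"
    and "valid_queries n (\<kappa> None)" "\<And>c. c \<in> set st \<Longrightarrow> valid_queries n (\<kappa> (Some c))"
  shows "valid_queries n (locate v st \<kappa>)"
  using assms by (induction st) auto

lemma map_hd_extend:
  assumes "c \<noteq> []"
  shows "map hd (extend v c st) = map hd st"
  using assms by (auto simp: extend_def)

lemma find_SomeD: "find Q xs = Some x \<Longrightarrow> x \<in> set xs \<and> Q x"
  by (auto simp: find_Some_iff)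

lemma find_NoneD: "find Q xs = None \<Longrightarrow> x \<in> set xs \<Longrightarrow> \<not> Q x"
  by (auto simp: find_None_iff)

text \<open>Validity concerns all branches, even those inconsistent with every clustering. It
  suffices that representatives are vertices already processed, hence different from the vertex
  being queried.\<close>

lemma valid_queries_grow:
  assumes "distinct vs" "set vs \<subseteq> {1..n}"
    and "\<And>c. c \<in> set st \<Longrightarrow> c \<noteq> [] \<and> hd c \<in> {1..n} - set vs"
  shows "valid_queries n (grow b M T vs st)"
  using assms
proof (induction vs arbitrary: st)
  case Nil
  then show ?case by simp
next
  case (Cons v vs)
  have v: "v \<in> {1..n}" using Cons.prems by simp
  have new: "valid_queries n (grow b M T vs ([v] # st))"
    by (rule Cons.IH) (use Cons.prems in auto)
  have ext: "valid_queries n (grow b M T vs (extend v c st))" if "c \<in> set st" for c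
  proof (rule Cons.IH)
    fix x assume "x \<in> set (extend v c st)"
    then show "x \<noteq> [] \<and> hd x \<in> {1..n} - set vs"
      using Cons.prems(3) that by (fastforce simp: extend_def split: if_splits)
  qed (use Cons.prems in auto)
  have ask: "valid_queries n (locate v st (\<lambda>r. case r of
         None \<Rightarrow> grow b M T vs ([v] # st)
       | Some c \<Rightarrow> if \<not> b \<and> M \<le> length c then Output {} else grow b M T vs (extend v c st)))"
    by (rule valid_queries_locate) (use v new ext Cons.prems(3) in fastforce)+
  show ?case
  proof (cases "find (\<lambda>c. M \<le> length c \<and> T v (take M c)) st")
    case None
    then show ?thesis using ask by (simp add: Let_def cong: option.case_cong)
  next
    case (Some c)
    then have c: "c \<in> set st" by (auto dest: find_SomeD)
    then have "hd c \<in> {1..n}" "hd c \<noteq> v" using Cons.prems(3)[OF c] by auto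
    then show ?thesis using ask ext[OF c] Some v
      by (cases b) (simp_all add: Let_def cong: option.case_cong)
  qed
qed

subsection \<open>Invariants of the strategy\<close>

text \<open>A potential: the number of vertices that sit in cores, complete or not.\<close>

definition filled :: "nat \<Rightarrow> nat list list \<Rightarrow> nat" where
  "filled M st = (\<Sum>c\<leftarrow>st. min M (length c))"

lemma filled_le: "filled M st \<le> M * length st"
  by (induction st) (auto simp: filled_def)

lemma filled_extend:
  assumes "distinct st" "c \<in> set st"
  shows "filled M (extend v c st) = filled M st + (if length c < M then 1 else 0)"
  using assms
proof (induction st)
  case (Cons a st)
  then show ?case
  proof (cases "a = c")
    case True
    then have "extend v c st = st" using Cons.prems by (auto simp: extend_def intro!: map_idI)
    then show ?thesis using True by (auto simp: extend_def filled_def)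
  next
    case False
    then show ?thesis using Cons by (auto simp: extend_def filled_def)
  qed
qed simp

definition cluster_of :: "nat set set \<Rightarrow> nat \<Rightarrow> nat set" where
  "cluster_of P u = {w. same_cluster P u w}"

text \<open>Deliberately weak: only representatives matter, so misplaced vertices do no harm, and
  query bounds that rest on it alone hold for every \<open>W\<close>.\<close>

definition seeded :: "nat \<Rightarrow> nat set set \<Rightarrow> nat list list \<Rightarrow> bool" where
  "seeded n P st \<longleftrightarrow> distinct (map (\<lambda>c. cluster_of P (hd c)) st) \<and>
     (\<forall>c\<in>set st. c \<noteq> [] \<and> hd c \<in> {1..n})"

text \<open>All vertices smaller than \<open>v\<close> have been clustered correctly.\<close>

definition tracks :: "nat set set \<Rightarrow> nat \<Rightarrow> nat list list \<Rightarrow> bool" where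
  "tracks P v st \<longleftrightarrow> set st = (\<lambda>C. filter (\<lambda>u. u \<in> C) [1..<v]) ` P - {[]}"

text \<open>Computed from the true cluster, hence fixed before \<open>W\<close> is drawn. A cluster
  with fewer than \<open>M\<close> vertices gives a list shorter than \<open>M\<close>.\<close>

definition core :: "nat \<Rightarrow> nat \<Rightarrow> nat set \<Rightarrow> nat list" where
  "core n M C = take M (filter (\<lambda>u. u \<in> C) [1..<Suc n])"

text \<open>The good event. Incomplete cores are left out because no test uses them, and members of
  the core because a vertex is tested only against smaller vertices while the state is
  exact.\<close>

definition tests_correct ::
  "nat \<Rightarrow> nat set set \<Rightarrow> nat \<Rightarrow> (nat \<Rightarrow> nat list \<Rightarrow> bool) \<Rightarrow> bool" where
  "tests_correct n P M T \<longleftrightarrow> (\<forall>v\<in>{1..n}. \<forall>C\<in>P.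
     length (core n M C) = M \<and> v \<notin> set (core n M C) \<longrightarrow> (T v (core n M C) \<longleftrightarrow> v \<in> C))"

lemma image_image_Diff_cong:
  assumes "\<And>x. x \<in> A \<Longrightarrow> f x = g (h x)" "\<And>x. x \<in> A \<Longrightarrow> f x \<in> B \<longleftrightarrow> h x \<in> B"
  shows "g ` (h ` A - B) = f ` A - B"
  using assms by (auto simp: image_iff)

section \<open>The hidden partition and query bounds that hold for arbitrary tests\<close>

locale clustering =
  fixes n :: nat and P :: "nat set set"
  assumes partition: "partition_on {1..n} P"
begin

lemma cluster_of_eq: "C \<in> P \<Longrightarrow> u \<in> C \<Longrightarrow> cluster_of P u = C"
  using partition_onD2[OF partition]
  by (auto simp: cluster_of_def same_cluster_def disjoint_def)

lemma in_some_cluster: "u \<in> {1..n} \<Longrightarrow> \<exists>C\<in>P. u \<in> C"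
  using partition_onD1[OF partition] by auto

lemma cluster_subset: "C \<in> P \<Longrightarrow> C \<subseteq> {1..n}"
  using partition_onD1[OF partition] by auto

lemma cluster_of_in: "u \<in> {1..n} \<Longrightarrow> cluster_of P u \<in> P"
  using in_some_cluster cluster_of_eq by blast

lemma same_cluster_iff:
  assumes "u \<in> {1..n}" "w \<in> {1..n}"
  shows "same_cluster P u w \<longleftrightarrow> cluster_of P u = cluster_of P w"
proof
  assume "same_cluster P u w"
  then show "cluster_of P u = cluster_of P w"
    unfolding same_cluster_def using cluster_of_eq by blast
next
  obtain C where C: "C \<in> P" "w \<in> C" using in_some_cluster[OF assms(2)] by blast
  assume "cluster_of P u = cluster_of P w"
  also have "\<dots> = C" using C by (rule cluster_of_eq)
  finally show "same_cluster P u w" using C by (auto simp: cluster_of_def)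
qed

lemma finite_clustering: "finite P"
  using finite_elements[OF _ partition] by simp

lemma card_clustering_le: "card P \<le> n"
proof -
  have "P \<subseteq> cluster_of P ` {1..n}"
  proof
    fix C assume C: "C \<in> P"
    then obtain u where "u \<in> C" using partition_onD3[OF partition] by (metis equals0I)
    then show "C \<in> cluster_of P ` {1..n}"
      using C cluster_of_eq[of C u] cluster_subset[of C] by blast
  qed
  then have "card P \<le> card (cluster_of P ` {1..n})" by (intro card_mono) auto
  also have "\<dots> \<le> card {1..n}" by (rule card_image_le) simp
  finally show ?thesis by simp
qed

lemma seeded_length: "seeded n P st \<Longrightarrow> length st \<le> card P"
proof -
  assume s: "seeded n P st"
  then have "set (map (\<lambda>c. cluster_of P (hd c)) st) \<subseteq> P"
    using cluster_of_in by (auto simp: seeded_def)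
  then have "card (set (map (\<lambda>c. cluster_of P (hd c)) st)) \<le> card P"
    by (rule card_mono[OF finite_clustering])
  moreover have "card (set (map (\<lambda>c. cluster_of P (hd c)) st)) = length st"
    using s distinct_card unfolding seeded_def by fastforce
  ultimately show ?thesis by simp
qed

lemma seeded_distinct: "seeded n P st \<Longrightarrow> distinct st"
  by (simp add: seeded_def distinct_map)

lemma seeded_filled: "seeded n P st \<Longrightarrow> filled M st \<le> card P * M"
  using filled_le[of M st] seeded_length[of st] by (metis le_trans mult.commute mult_le_mono2)

text \<open>No head changes. Whether \<open>v\<close> belongs to the extended list is irrelevant,
  which is why test errors preserve the invariant.\<close>

lemma seeded_extend:
  assumes "seeded n P st" "c \<in> set st"
  shows "seeded n P (extend v c st)"
proof -
  have "c \<noteq> []" using assms by (auto simp: seeded_def)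
  then have "map (cluster_of P) (map hd (extend v c st)) = map (cluster_of P) (map hd st)"
    by (simp only: map_hd_extend[OF \<open>c \<noteq> []\<close>])
  then have "map (\<lambda>c. cluster_of P (hd c)) (extend v c st) = map (\<lambda>c. cluster_of P (hd c)) st"
    by (simp add: comp_def)
  moreover have "x \<noteq> [] \<and> hd x \<in> {1..n}" if "x \<in> set (extend v c st)" for x
    using that assms by (auto simp: seeded_def extend_def)
  ultimately show ?thesis using assms(1) by (simp add: seeded_def)
qed

text \<open>Negative answers from all representatives certify that the cluster of \<open>v\<close>
  has not been seen before.\<close>

lemma seeded_new:
  assumes "seeded n P st" "v \<in> {1..n}" "find (\<lambda>c. same_cluster P v (hd c)) st = None"
  shows "seeded n P ([v] # st)"
  using assms same_cluster_iff by (fastforce simp: seeded_def dest: find_NoneD)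

text \<open>The potential \<open>filled M st\<close> grows with each queried vertex, except for the one that triggers the
  abort.\<close>

lemma num_queries_grow_unverified:
  assumes "seeded n P st" "set vs \<subseteq> {1..n}" and M: "0 < M"
  shows "num_queries P (grow False M T vs st) + card P * filled M st
           \<le> card P * (card P * M + 1)"
  using assms(1,2)
proof (induction vs arbitrary: st)
  case Nil
  then have "card P * filled M st \<le> card P * (card P * M)"
    using seeded_filled mult_le_mono2 by blast
  then show ?case unfolding grow.simps num_queries.simps by (simp only: add_mult_distrib2)
next
  case (Cons v vs)
  have v: "v \<in> {1..n}" using Cons.prems by simp
  have len: "length st \<le> card P" using Cons.prems seeded_length by blast
  have d: "distinct st" using Cons.prems seeded_distinct by blast
  let ?\<kappa> = "\<lambda>r. case r of
         None \<Rightarrow> grow False M T vs ([v] # st)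
       | Some c \<Rightarrow> if \<not> False \<and> M \<le> length c then Output {} else grow False M T vs (extend v c st)"
  have ext: "num_queries P (grow False M T vs (extend v c st)) + card P * filled M (extend v c st)
           \<le> card P * (card P * M + 1)" if "c \<in> set st" for c
    by (rule Cons.IH) (use Cons.prems that seeded_extend in auto)
  let ?r = "find (\<lambda>c. same_cluster P v (hd c)) st"
  have ask: "num_queries P (locate v st ?\<kappa>) + card P * filled M st \<le> card P * (card P * M + 1)"
  proof -
    \<comment> \<open>The extra \<open>card P\<close> pays for the at most \<open>length st\<close>
      queries of this round.\<close>
    have "num_queries P (?\<kappa> ?r) + card P + card P * filled M st \<le> card P * (card P * M + 1)"
    proof (cases ?r)
      case None
      have "num_queries P (grow False M T vs ([v] # st)) + card P * filled M ([v] # st)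
           \<le> card P * (card P * M + 1)"
        by (rule Cons.IH) (use Cons.prems None v seeded_new in auto)
      \<comment> \<open>Because \<open>0 < M\<close>, the first member of a new cluster already
        counts as a core vertex, so the potential pays for the round.\<close>
      moreover have "filled M ([v] # st) = Suc (filled M st)"
        using M by (simp add: filled_def)
      ultimately show ?thesis using None by simp
    next
      case (Some c)
      then have c: "c \<in> set st" by (auto dest: find_SomeD)
      show ?thesis
      proof (cases "M \<le> length c")
        case True
        \<comment> \<open>The abort leaves the potential unchanged; the \<open>+ 1\<close> in the
          bound pays for this last round.\<close>
        have "card P * filled M st \<le> card P * (card P * M)"
          using seeded_filled[OF Cons.prems(1)] by simp
        then show ?thesis using Some True by (simp add: algebra_simps)
      next
        case False
        then show ?thesis using Some ext[OF c] filled_extend[OF d c] by (simp add: algebra_simps)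
      qed
    qed
    then show ?thesis using num_queries_locate[of P v st ?\<kappa>] len by linarith
  qed
  show ?case
  proof (cases "find (\<lambda>c. M \<le> length c \<and> T v (take M c)) st")
    case None
    then show ?thesis using ask by (simp add: Let_def cong: option.case_cong)
  next
    case (Some c)
    \<comment> \<open>A passed test costs no query, and the full list leaves the potential as it
      was.\<close>
    then have "c \<in> set st" "M \<le> length c" by (auto dest: find_SomeD)
    then show ?thesis using ext[of c] filled_extend[OF d, of c M v] Some by (simp add: Let_def)
  qed
qed

text \<open>Per vertex there is at most one refuted confirmation followed by one query for each
  known cluster, whatever the tests say. This crude bound serves the event that some test
  errs.\<close>

lemma num_queries_grow_verified_le:
  assumes "seeded n P st" "set vs \<subseteq> {1..n}"
  shows "num_queries P (grow True M T vs st) \<le> (card P + 1) * length vs"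
  using assms
proof (induction vs arbitrary: st)
  case Nil
  then show ?case by simp
next
  case (Cons v vs)
  have v: "v \<in> {1..n}" using Cons.prems by simp
  have len: "length st \<le> card P" using Cons.prems seeded_length by blast
  let ?\<kappa> = "\<lambda>r. case r of
         None \<Rightarrow> grow True M T vs ([v] # st)
       | Some c \<Rightarrow> grow True M T vs (extend v c st)"
  have grown: "num_queries P (grow True M T vs (extend v c st)) \<le> (card P + 1) * length vs"
    if "c \<in> set st" for c
    by (rule Cons.IH) (use Cons.prems that seeded_extend in auto)
  let ?r = "find (\<lambda>c. same_cluster P v (hd c)) st"
  have "num_queries P (?\<kappa> ?r) \<le> (card P + 1) * length vs"
  proof (cases ?r)
    case None
    have "num_queries P (grow True M T vs ([v] # st)) \<le> (card P + 1) * length vs"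
      by (rule Cons.IH) (use Cons.prems None v seeded_new in auto)
    then show ?thesis using None by simp
  next
    case (Some c)
    then show ?thesis using grown[of c] by (auto dest: find_SomeD)
  qed
  then have ask: "num_queries P (locate v st ?\<kappa>) \<le> card P + (card P + 1) * length vs"
    using num_queries_locate[of P v st ?\<kappa>] len by linarith
  show ?case
  proof (cases "find (\<lambda>c. M \<le> length c \<and> T v (take M c)) st")
    case None
    then show ?thesis using ask by (simp add: Let_def cong: option.case_cong)
  next
    case (Some c)
    then have "c \<in> set st" by (auto dest: find_SomeD)
    then show ?thesis using ask grown[of c] Some by (simp add: Let_def)
  qed
qed

section \<open>Exact tracking of the clusters\<close>

lemma tracks_cluster:
  assumes "tracks P v st" "c \<in> set st"
  obtains C where "C \<in> P" "c = filter (\<lambda>u. u \<in> C) [1..<v]" "c \<noteq> []"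
    "\<And>w. same_cluster P w (hd c) \<longleftrightarrow> w \<in> C"
proof -
  obtain C where C: "C \<in> P" "c = filter (\<lambda>u. u \<in> C) [1..<v]" "c \<noteq> []"
    using assms by (auto simp: tracks_def)
  then have "hd c \<in> set c" by (intro hd_in_set)
  then have hd: "hd c \<in> C" using C(2) by (metis (mono_tags, lifting) filter_set Set.filter_eq mem_Collect_eq)
  have "same_cluster P w (hd c) \<longleftrightarrow> w \<in> C" for w
  proof
    assume "same_cluster P w (hd c)"
    then obtain D where "D \<in> P" "w \<in> D" "hd c \<in> D" by (auto simp: same_cluster_def)
    then show "w \<in> C" using cluster_of_eq C(1) hd by blast
  qed (use C(1) hd in \<open>auto simp: same_cluster_def\<close>)
  then show thesis using that C by blast
qed

text \<open>As \<open>[1..<v]\<close> is increasing, the step to \<open>Suc v\<close> appends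
  \<open>v\<close> to the list of its own cluster and leaves all others alone.\<close>

lemma tracks_extend:
  assumes t: "tracks P v st" and "1 \<le> v" and c: "c \<in> set st" and sc: "same_cluster P v (hd c)"
  shows "tracks P (Suc v) (extend v c st)"
proof -
  let ?F = "\<lambda>v C. filter (\<lambda>u. u \<in> C) [1..<v]"
  let ?g = "\<lambda>x. if x = c then c @ [v] else x"
  obtain C where C: "C \<in> P" "c = ?F v C" "c \<noteq> []" "v \<in> C"
    using tracks_cluster[OF t c] sc by metis
  have F: "?F (Suc v) D = (if v \<in> D then ?F v D @ [v] else ?F v D)" for D
    using \<open>1 \<le> v\<close> by simp
  have uniq: "D = C" if "D \<in> P" "u \<in> D" "u \<in> C" for D u
    using cluster_of_eq that C(1) by metis
  \<comment> \<open>Different clusters never share a nonempty list, so replacement by value touches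
    only the list of \<open>C\<close>.\<close>
  have same: "D = C" if "D \<in> P" "?F v D = c" for D
  proof -
    have "hd c \<in> set c" using C(3) by (rule hd_in_set)
    then have "hd c \<in> set (?F v D)" "hd c \<in> set (?F v C)" using that(2) C(2) by simp_all
    then show ?thesis using uniq[OF that(1), of "hd c"] by (simp only: set_filter mem_Collect_eq)
  qed
  \<comment> \<open>The second conjunct says that no list becomes empty or nonempty, so discarding
    \<open>[]\<close> commutes with the update.\<close>
  have step: "?F (Suc v) D = ?g (?F v D) \<and> (?F (Suc v) D \<in> {[]} \<longleftrightarrow> ?F v D \<in> {[]})"
    if "D \<in> P" for D
  proof (cases "v \<in> D")
    case True
    then have "D = C" using uniq that C(4) by blast
    then show ?thesis using F[of C] C(2-4) by simp
  next
    case False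
    then have "?F v D \<noteq> c" using same that C(4) by blast
    then show ?thesis using F[of D] False by simp
  qed
  have "set (extend v c st) = ?g ` (?F v ` P - {[]})"
    using t by (simp add: extend_def tracks_def)
  also have "\<dots> = ?F (Suc v) ` P - {[]}"
    by (rule image_image_Diff_cong) (use step in blast)+
  finally show ?thesis by (simp only: tracks_def)
qed

lemma tracks_new:
  assumes t: "tracks P v st" and v: "v \<in> {1..n}"
    and none: "find (\<lambda>c. same_cluster P v (hd c)) st = None"
  shows "tracks P (Suc v) ([v] # st)"
proof -
  let ?F = "\<lambda>v C. filter (\<lambda>u. u \<in> C) [1..<v]"
  obtain C where C: "C \<in> P" "v \<in> C" using in_some_cluster[OF v] by blast
  have F: "?F (Suc v) D = (if v \<in> D then ?F v D @ [v] else ?F v D)" for D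
    using v by simp
  have uniq: "D = C" if "D \<in> P" "v \<in> D" for D
    using cluster_of_eq that C by metis
  \<comment> \<open>An earlier member of \<open>C\<close> would supply a representative that answers
    \<open>+1\<close> for \<open>v\<close>.\<close>
  have empty: "?F v C = []"
  proof (rule ccontr)
    assume ne: "?F v C \<noteq> []"
    then have "?F v C \<in> set st" using C t unfolding tracks_def by blast
    moreover have "hd (?F v C) \<in> set (?F v C)" using ne by (rule hd_in_set)
    then have "same_cluster P v (hd (?F v C))" using C by (auto simp: same_cluster_def)
    ultimately show False using find_NoneD[OF none] by blast
  qed
  have others: "?F (Suc v) D = ?F v D" if "D \<in> P - {C}" for D
    using F[of D] uniq[of D] that by auto
  have "?F (Suc v) ` P = insert (?F (Suc v) C) (?F (Suc v) ` (P - {C}))" using C by blast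
  also have "?F (Suc v) C = [v]" using F[of C] C empty by simp
  also have "?F (Suc v) ` (P - {C}) = ?F v ` (P - {C})" by (rule image_cong[OF refl others])
  finally have "?F (Suc v) ` P - {[]} = insert [v] (?F v ` (P - {C}) - {[]})" by auto
  also have "?F v ` (P - {C}) - {[]} = ?F v ` P - {[]}" using empty by auto
  finally show ?thesis using t by (simp only: tracks_def list.set)
qed

lemma tracks_initial: "tracks P 1 []"
  by (auto simp: tracks_def)

lemma tracks_final:
  assumes "tracks P (Suc n) st"
  shows "set ` set st = P"
proof -
  have eq: "set (filter (\<lambda>u. u \<in> C) [1..<Suc n]) = C" if "C \<in> P" for C
    using cluster_subset[OF that] by auto
  then have "filter (\<lambda>u. u \<in> C) [1..<Suc n] \<noteq> []" if "C \<in> P" for C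
    using that partition_onD3[OF partition] by (metis list.set(1))
  then have "set st = (\<lambda>C. filter (\<lambda>u. u \<in> C) [1..<Suc n]) ` P"
    using assms unfolding tracks_def by blast
  then have "set ` set st = (\<lambda>C. set (filter (\<lambda>u. u \<in> C) [1..<Suc n])) ` P"
    by (simp only: image_image)
  also have "\<dots> = (\<lambda>C. C) ` P" by (rule image_cong[OF refl eq])
  finally show ?thesis by simp
qed

text \<open>The bridge from the state, which depends on \<open>W\<close>, to the fixed cores: a
  tracked list with at least \<open>M\<close> entries is a prefix of the full enumeration of its
  cluster, so its first \<open>M\<close> entries are the core.\<close>

lemma tests_correct_full:
  assumes G: "tests_correct n P M T" and t: "tracks P v st" and v: "v \<in> {1..n}"
    and c: "c \<in> set st" and full: "M \<le> length c"
  shows "T v (take M c) \<longleftrightarrow> same_cluster P v (hd c)"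
proof -
  obtain C where C: "C \<in> P" "c = filter (\<lambda>u. u \<in> C) [1..<v]"
    "\<And>w. same_cluster P w (hd c) \<longleftrightarrow> w \<in> C"
    using tracks_cluster[OF t c] by metis
  have "[1..<Suc n] = [1..<v] @ [v..<Suc n]"
    using v upt_add_eq_append[of 1 v "Suc n - v"] by simp
  then have "core n M C = take M c"
    unfolding core_def using full C(2) by simp
  moreover have "v \<notin> set (take M c)" using C(2) by (auto dest: in_set_takeD)
  moreover have "length (take M c) = M" using full by simp
  ultimately show ?thesis using G v C(1,3) unfolding tests_correct_def by metis
qed

text \<open>With verification, a refuted test falls back to asking, so the state stays exact for any
  tests. Without it, correct tests keep the state exact and rule out the abort.\<close>

lemma result_grow:
  assumes "tracks P v st" "1 \<le> v" "v \<le> Suc n" "b \<or> tests_correct n P M T" "vs = [v..<Suc n]"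
  shows "result P (grow b M T vs st) = P"
  using assms
proof (induction vs arbitrary: v st)
  case Nil
  then show ?case using tracks_final by (auto simp: le_Suc_eq)
next
  case (Cons v' vs)
  then have [simp]: "v' = v" and vs: "vs = [Suc v..<Suc n]" and v: "v \<in> {1..n}"
    by (auto simp: upt_eq_Cons_conv[symmetric] upt_rec[of v "Suc n"] simp del: upt_Suc split: if_splits)
  let ?\<kappa> = "\<lambda>r. case r of
         None \<Rightarrow> grow b M T vs ([v] # st)
       | Some c \<Rightarrow> if \<not> b \<and> M \<le> length c then Output {} else grow b M T vs (extend v c st)"
  let ?r = "find (\<lambda>c. same_cluster P v (hd c)) st"
  have grown: "result P (grow b M T vs (extend v c st)) = P"
    if "c \<in> set st" "same_cluster P v (hd c)" for c
    by (rule Cons.IH[OF tracks_extend]) (use Cons.prems that v vs in auto)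
  have ask: "result P (locate v st ?\<kappa>) = P"
    if "b \<or> find (\<lambda>c. M \<le> length c \<and> T v (take M c)) st = None"
  proof (cases ?r)
    case None
    have "result P (grow b M T vs ([v] # st)) = P"
      by (rule Cons.IH[OF tracks_new]) (use Cons.prems None v vs in auto)
    then show ?thesis using None by (simp add: result_locate)
  next
    case (Some c)
    then have c: "c \<in> set st" "same_cluster P v (hd c)" by (auto dest: find_SomeD)
    \<comment> \<open>Without verification, asking means that no test passed; a full list of the
      cluster of \<open>v\<close> would have passed, so the abort branch is unreachable.\<close>
    have "b \<or> \<not> M \<le> length c"
      using that Cons.prems(4) tests_correct_full[OF _ Cons.prems(1) v c(1)] c find_NoneD by fastforce
    then show ?thesis using Some grown[OF c] by (auto simp: result_locate)
  qed
  show ?case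
  proof (cases "find (\<lambda>c. M \<le> length c \<and> T v (take M c)) st")
    case None
    then show ?thesis using ask by (simp add: Let_def cong: option.case_cong)
  next
    case (Some c)
    then have c: "c \<in> set st" "M \<le> length c" "T v (take M c)" by (auto dest: find_SomeD)
    show ?thesis
    proof (cases b)
      case True
      then show ?thesis using Some ask grown[OF c(1)] by (simp add: Let_def oracle_answer_def)
    next
      case False
      then have "same_cluster P v (hd c)"
        using Cons.prems(4) tests_correct_full[OF _ Cons.prems(1) v c(1,2)] c(3) by blast
      then show ?thesis using Some grown[OF c(1)] False by (simp add: Let_def)
    qed
  qed
qed

text \<open>A vertex costs either one confirming query, counted by \<open>length vs\<close>, or a
  round of queries paid by the growth of the potential.\<close>

lemma num_queries_grow_verified:
  assumes "seeded n P st" "tracks P v st" "1 \<le> v" "v \<le> Suc n" "vs = [v..<Suc n]"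
    and G: "tests_correct n P M T" and M: "0 < M"
  shows "num_queries P (grow True M T vs st) + card P * filled M st
           \<le> length vs + card P * (card P * M)"
  using assms(1-5)
proof (induction vs arbitrary: v st)
  case Nil
  then have "card P * filled M st \<le> card P * (card P * M)"
    using seeded_filled mult_le_mono2 by blast
  then show ?case unfolding grow.simps num_queries.simps by (simp only: add_mult_distrib2)
next
  case (Cons v' vs)
  then have [simp]: "v' = v" and vs: "vs = [Suc v..<Suc n]" and v: "v \<in> {1..n}"
    by (auto simp: upt_eq_Cons_conv[symmetric] upt_rec[of v "Suc n"] simp del: upt_Suc split: if_splits)
  have len: "length st \<le> card P" using Cons.prems seeded_length by blast
  have d: "distinct st" using Cons.prems seeded_distinct by blast
  let ?\<kappa> = "\<lambda>r. case r of
         None \<Rightarrow> grow True M T vs ([v] # st)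
       | Some c \<Rightarrow> grow True M T vs (extend v c st)"
  let ?r = "find (\<lambda>c. same_cluster P v (hd c)) st"
  have grown: "num_queries P (grow True M T vs (extend v c st)) + card P * filled M (extend v c st)
      \<le> length vs + card P * (card P * M)"
    if "c \<in> set st" "same_cluster P v (hd c)" for c
    by (rule Cons.IH[OF seeded_extend tracks_extend]) (use Cons.prems that v vs in auto)
  show ?case
  proof (cases "find (\<lambda>c. M \<le> length c \<and> T v (take M c)) st")
    case none: None
    have "num_queries P (?\<kappa> ?r) + card P + card P * filled M st \<le> length vs + card P * (card P * M)"
    proof (cases ?r)
      case None
      have "num_queries P (grow True M T vs ([v] # st)) + card P * filled M ([v] # st)
          \<le> length vs + card P * (card P * M)"
        by (rule Cons.IH[OF seeded_new tracks_new]) (use Cons.prems None v vs in auto)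
      moreover have "filled M ([v] # st) = Suc (filled M st)"
        using M by (simp add: filled_def)
      ultimately show ?thesis using None by simp
    next
      case (Some c)
      then have c: "c \<in> set st" "same_cluster P v (hd c)" by (auto dest: find_SomeD)
      have "\<not> M \<le> length c"
        using tests_correct_full[OF G Cons.prems(2) v c(1)] c find_NoneD[OF none c(1)] by blast
      then show ?thesis using Some grown[OF c] filled_extend[OF d c(1)] by (simp add: algebra_simps)
    qed
    then have "num_queries P (locate v st ?\<kappa>) + card P * filled M st
        \<le> length vs + card P * (card P * M)"
      using num_queries_locate[of P v st ?\<kappa>] len by linarith
    then show ?thesis using none by (simp add: Let_def)
  next
    case (Some c)
    then have c: "c \<in> set st" "M \<le> length c" "T v (take M c)" by (auto dest: find_SomeD)
    then have sc: "same_cluster P v (hd c)"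
      using tests_correct_full[OF G Cons.prems(2) v] by blast
    then show ?thesis using Some grown[OF c(1) sc] filled_extend[OF d c(1)] c(2)
      by (simp add: Let_def oracle_answer_def)
  qed
qed

end

subsection \<open>Error probability of the likelihood ratio tests\<close>

text \<open>A tie fails the test. The error bound covers ties, since it only uses that the wrong
  hypothesis is at least as likely as the right one.\<close>

definition likelihood_test ::
  "real pmf \<Rightarrow> real pmf \<Rightarrow> (nat \<Rightarrow> nat \<Rightarrow> real) \<Rightarrow> nat \<Rightarrow> nat list \<Rightarrow> bool" where
  "likelihood_test fp fm W v K \<longleftrightarrow> (\<Sum>u\<in>set K. ln (pmf fp (W u v) / pmf fm (W u v))) > 0"

text \<open>By symmetry take \<open>q \<le> p\<close>; then \<open>ln x \<le> x - 1\<close> at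
  \<open>x = p / q\<close> suffices. Summed up, it bounds the symmetric divergence by squared
  differences.\<close>

lemma diff_mult_ln_diff_le:
  fixes p q e :: real
  assumes "0 < e" "e \<le> p" "e \<le> q"
  shows "(p - q) * (ln p - ln q) \<le> (p - q)\<^sup>2 / e"
proof -
  have *: "(p - q) * (ln p - ln q) \<le> (p - q)\<^sup>2 / e" if "q \<le> p" "e \<le> q" for p q :: real
  proof -
    have pos: "0 < q" "0 < p" using assms(1) that by auto
    have "ln p - ln q = ln (p / q)" using pos by (simp add: ln_div)
    also have "\<dots> \<le> p / q - 1" using pos by (intro ln_le_minus_one) simp
    also have "\<dots> = (p - q) / q" using pos by (simp add: field_simps)
    also have "\<dots> \<le> (p - q) / e" using pos assms(1) that by (intro divide_left_mono) auto
    finally have "(p - q) * (ln p - ln q) \<le> (p - q) * ((p - q) / e)"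
      using that by (intro mult_left_mono) auto
    then show ?thesis by (simp add: power2_eq_square)
  qed
  show ?thesis
  proof (cases "q \<le> p")
    case True
    then show ?thesis using * assms by blast
  next
    case False
    then have "(q - p) * (ln q - ln p) \<le> (q - p)\<^sup>2 / e" using *[of p q] assms by auto
    then show ?thesis by (simp add: algebra_simps power2_eq_square)
  qed
qed

lemma diff_mult_ln_diff_pos:
  fixes p q :: real
  assumes "0 < p" "0 < q" "p \<noteq> q"
  shows "0 < (p - q) * (ln p - ln q)"
  using assms by (cases "q < p") (auto intro: mult_pos_pos mult_neg_neg)

text \<open>Factor \<open>p - q\<close> over the square roots; the sum of the roots is at most
  2.\<close>

lemma square_diff_le_sqrt_diff:
  fixes p q :: real
  assumes "0 \<le> p" "p \<le> 1" "0 \<le> q" "q \<le> 1"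
  shows "(p - q)\<^sup>2 \<le> 4 * (sqrt p - sqrt q)\<^sup>2"
proof -
  have "p - q = (sqrt p + sqrt q) * (sqrt p - sqrt q)"
    using assms by (simp add: algebra_simps)
  then have "(p - q)\<^sup>2 = (sqrt p + sqrt q)\<^sup>2 * (sqrt p - sqrt q)\<^sup>2"
    by (simp add: power_mult_distrib)
  moreover have "sqrt p \<le> 1" "sqrt q \<le> 1" using assms by auto
  then have "sqrt p + sqrt q \<le> 2" by linarith
  then have "(sqrt p + sqrt q)\<^sup>2 \<le> 2\<^sup>2" using assms by (intro power_mono) auto
  then have "(sqrt p + sqrt q)\<^sup>2 * (sqrt p - sqrt q)\<^sup>2 \<le> 2\<^sup>2 * (sqrt p - sqrt q)\<^sup>2"
    by (rule mult_right_mono) simp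
  ultimately show ?thesis by simp
qed

section \<open>Symmetric divergence and Bhattacharyya coefficient\<close>

locale separated_pmfs =
  fixes S :: "real set" and fp fm :: "real pmf" and \<epsilon> :: real
  assumes finS: "finite S" and eps: "0 < \<epsilon>"
    and supp: "set_pmf fp \<subseteq> S" "set_pmf fm \<subseteq> S"
    and lower: "\<And>x. x \<in> S \<Longrightarrow> \<epsilon> \<le> pmf fp x" "\<And>x. x \<in> S \<Longrightarrow> \<epsilon> \<le> pmf fm x"
    and neq: "fp \<noteq> fm"
begin

text \<open>The Bhattacharyya coefficient.\<close>

definition affinity :: real where
  "affinity = (\<Sum>x\<in>S. sqrt (pmf fp x * pmf fm x))"

lemma pos: "x \<in> S \<Longrightarrow> 0 < pmf fp x" "x \<in> S \<Longrightarrow> 0 < pmf fm x"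
  using lower[of x] eps by linarith+

lemma set_pmf_eq: "set_pmf fp = S" "set_pmf fm = S"
  using supp pos by (force simp: set_pmf_iff)+

lemma sym_div_eq:
  "sym_div fp fm = (\<Sum>x\<in>S. (pmf fp x - pmf fm x) * (ln (pmf fp x) - ln (pmf fm x)))"
  unfolding sym_div_def KL_div_def set_pmf_eq sum.distrib[symmetric]
proof (intro sum.cong refl)
  fix x assume "x \<in> S"
  then have "0 < pmf fp x" "0 < pmf fm x" by (rule pos)+
  then show "pmf fp x * ln (pmf fp x / pmf fm x) + pmf fm x * ln (pmf fm x / pmf fp x)
      = (pmf fp x - pmf fm x) * (ln (pmf fp x) - ln (pmf fm x))"
    by (simp add: ln_div algebra_simps)
qed

lemma sum_pmf: "(\<Sum>x\<in>S. pmf fp x) = 1" "(\<Sum>x\<in>S. pmf fm x) = 1"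
  by (rule sum_pmf_eq_1[OF finS supp(1)], rule sum_pmf_eq_1[OF finS supp(2)])

text \<open>Monotonicity of \<open>ln\<close> makes every summand nonnegative, and strictly positive
  where the two distributions differ.\<close>

lemma sym_div_pos: "0 < sym_div fp fm"
proof -
  obtain x where ne: "pmf fp x \<noteq> pmf fm x" using neq by (meson pmf_eqI)
  then have "pmf fp x \<noteq> 0 \<or> pmf fm x \<noteq> 0" by linarith
  then have "x \<in> S" unfolding set_pmf_iff[symmetric] using supp by blast
  then have x: "x \<in> S" "0 < (pmf fp x - pmf fm x) * (ln (pmf fp x) - ln (pmf fm x))"
    using diff_mult_ln_diff_pos[OF pos(1,2)[OF \<open>x \<in> S\<close>] ne] by simp_all
  have "0 \<le> (pmf fp y - pmf fm y) * (ln (pmf fp y) - ln (pmf fm y))" if "y \<in> S" for y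
    using diff_mult_ln_diff_pos[OF pos(1,2)[OF that]] by (cases "pmf fp y = pmf fm y") auto
  then show ?thesis unfolding sym_div_eq using x by (intro sum_pos2[OF finS x(1)]) auto
qed

lemma sym_div_le_squares: "\<epsilon> * sym_div fp fm \<le> (\<Sum>x\<in>S. (pmf fp x - pmf fm x)\<^sup>2)"
proof -
  have "sym_div fp fm \<le> (\<Sum>x\<in>S. (pmf fp x - pmf fm x)\<^sup>2 / \<epsilon>)"
    unfolding sym_div_eq by (intro sum_mono diff_mult_ln_diff_le eps lower)
  also have "\<dots> = (\<Sum>x\<in>S. (pmf fp x - pmf fm x)\<^sup>2) / \<epsilon>" by (simp add: sum_divide_distrib)
  finally show ?thesis using eps by (simp add: field_simps)
qed

text \<open>An upper bound on the divergence keeps the sample scale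
  \<open>ln n / sym_div fp fm\<close> away from 0, so that additive constants can later be
  absorbed.\<close>

lemma sym_div_le: "\<epsilon> * sym_div fp fm \<le> 2"
proof -
  have "(\<Sum>x\<in>S. (pmf fp x - pmf fm x)\<^sup>2) \<le> (\<Sum>x\<in>S. pmf fp x + pmf fm x)"
  proof (intro sum_mono)
    fix x
    have nonneg: "0 \<le> pmf fp x" "0 \<le> pmf fm x" by simp_all
    have le_1: "pmf fp x \<le> 1" "pmf fm x \<le> 1" by (simp_all add: pmf_le_1)
    have "\<bar>pmf fp x - pmf fm x\<bar> \<le> 1" using nonneg le_1 by linarith
    then have "\<bar>pmf fp x - pmf fm x\<bar> * \<bar>pmf fp x - pmf fm x\<bar> \<le> 1 * \<bar>pmf fp x - pmf fm x\<bar>"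
      by (rule mult_right_mono) simp
    then have "(pmf fp x - pmf fm x)\<^sup>2 \<le> \<bar>pmf fp x - pmf fm x\<bar>"
      by (simp add: power2_eq_square)
    then show "(pmf fp x - pmf fm x)\<^sup>2 \<le> pmf fp x + pmf fm x" using nonneg by linarith
  qed
  also have "\<dots> = 2" by (simp add: sum.distrib sum_pmf)
  finally show ?thesis using sym_div_le_squares by linarith
qed

lemma affinity_nonneg: "0 \<le> affinity"
  by (simp add: affinity_def sum_nonneg)

text \<open>The squared differences of the roots sum to \<open>2 - 2 * affinity\<close>, a Hellinger
  distance; the factor 4 from comparing squares turns this into the 8. Then
  \<open>1 + x \<le> exp x\<close>.\<close>

lemma affinity_le: "affinity \<le> exp (- (\<epsilon> * sym_div fp fm / 8))"
proof -
  have "\<epsilon> * sym_div fp fm \<le> (\<Sum>x\<in>S. 4 * (sqrt (pmf fp x) - sqrt (pmf fm x))\<^sup>2)"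
    using sym_div_le_squares
    by (rule order_trans) (intro sum_mono square_diff_le_sqrt_diff pmf_nonneg pmf_le_1)
  also have "\<dots> = (\<Sum>x\<in>S. 4 * pmf fp x + 4 * pmf fm x - 8 * sqrt (pmf fp x * pmf fm x))"
    by (intro sum.cong refl) (simp add: power2_diff real_sqrt_mult)
  also have "\<dots> = 8 - 8 * affinity"
    by (simp add: sum.distrib sum_subtractf sum_distrib_left[symmetric] sum_pmf affinity_def)
  finally have "affinity \<le> 1 + (- (\<epsilon> * sym_div fp fm / 8))" by simp
  also have "\<dots> \<le> exp (- (\<epsilon> * sym_div fp fm / 8))" by (rule exp_ge_add_one_self)
  finally show ?thesis .
qed

text \<open>Weighting the root of the ratio by \<open>f\<close> gives the root of the product, which
  is symmetric, so both kinds of test error have the same bound.\<close>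

lemma nn_integral_sqrt_ratio:
  assumes "f = fp \<and> g = fm \<or> f = fm \<and> g = fp"
  shows "(\<integral>\<^sup>+ x. ennreal (sqrt (pmf g x / pmf f x)) \<partial>measure_pmf f) = ennreal affinity"
proof -
  have S: "set_pmf f = S" and fpos: "\<And>x. x \<in> S \<Longrightarrow> 0 < pmf f x" "\<And>x. x \<in> S \<Longrightarrow> 0 < pmf g x"
    using assms set_pmf_eq pos by auto
  have "(\<integral>\<^sup>+ x. ennreal (sqrt (pmf g x / pmf f x)) \<partial>measure_pmf f)
      = (\<Sum>x\<in>S. ennreal (sqrt (pmf g x / pmf f x)) * ennreal (pmf f x))"
    using nn_integral_measure_pmf_finite[of f] S finS by simp
  also have "\<dots> = (\<Sum>x\<in>S. ennreal (sqrt (pmf fp x * pmf fm x)))"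
  proof (intro sum.cong refl)
    fix x assume x: "x \<in> S"
    have "sqrt (pmf g x / pmf f x) * pmf f x = sqrt (pmf g x) * (pmf f x / sqrt (pmf f x))"
      by (simp add: real_sqrt_divide)
    also have "\<dots> = sqrt (pmf fp x * pmf fm x)"
      using assms fpos[OF x] by (auto simp: real_div_sqrt real_sqrt_mult)
    finally show "ennreal (sqrt (pmf g x / pmf f x)) * ennreal (pmf f x)
        = ennreal (sqrt (pmf fp x * pmf fm x))"
      by (metis ennreal_mult' pmf_nonneg mult.commute)
  qed
  also have "\<dots> = ennreal affinity" unfolding affinity_def by (intro sum_ennreal) simp
  finally show ?thesis .
qed

end

text \<open>The factor \<open>8 / (\<epsilon> * sym_div fp fm)\<close> inverts the exponent of
  \<open>affinity_le\<close>. Of \<open>d + 2\<close>, the 2 pays for the union bound over at most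
  \<open>n^2\<close> pairs. \<open>Suc\<close> of the floor rounds up and keeps the size
  positive.\<close>

definition core_size :: "real \<Rightarrow> real \<Rightarrow> real pmf \<Rightarrow> real pmf \<Rightarrow> nat \<Rightarrow> nat" where
  "core_size d \<epsilon> fp fm n = Suc (nat \<lfloor>8 * (d + 2) * ln (real n) / (\<epsilon> * sym_div fp fm)\<rfloor>)"

definition cluster_tree ::
  "bool \<Rightarrow> real \<Rightarrow> real \<Rightarrow> real pmf \<Rightarrow> real pmf \<Rightarrow> nat \<Rightarrow> (nat \<Rightarrow> nat \<Rightarrow> real) \<Rightarrow> query_tree" where
  "cluster_tree b d \<epsilon> fp fm n W =
     grow b (core_size d \<epsilon> fp fm n) (likelihood_test fp fm W) [1..<Suc n] []"

section \<open>Test errors over the random matrix\<close>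

locale side_information = clustering n P + separated_pmfs S fp fm \<epsilon>
  for n P S fp fm \<epsilon>
begin

text \<open>Chernoff bound with exponent 1/2: an error forces the product of the roots of the
  likelihood ratios to be at least 1, and by independence its expectation is a power of
  \<open>affinity\<close>.\<close>

lemma prob_test_error:
  assumes v: "v \<in> {1..n}" and C: "C \<in> P" and K: "set K \<subseteq> C" "v \<notin> set K" "distinct K"
  shows "measure_pmf.prob (side_info n P fp fm) {W. likelihood_test fp fm W v K \<noteq> (v \<in> C)}
           \<le> affinity ^ length K"
proof -
  \<comment> \<open>\<open>f\<close> is the true law of the tested entries, \<open>g\<close> the law
    under the wrong hypothesis.\<close>
  define f where "f = (if v \<in> C then fp else fm)"
  define g where "g = (if v \<in> C then fm else fp)"
  define E where "E = {(u, v). u \<in> {1..n} \<and> v \<in> {1..n} \<and> u < v}"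
  define p where "p = (\<lambda>(u, v). if same_cluster P u v then fp else fm)"
  define e where "e = (\<lambda>u. (min u v, max u v))"
  define h :: "(nat \<times> nat \<Rightarrow> real) \<Rightarrow> nat \<Rightarrow> nat \<Rightarrow> real"
    where "h = (\<lambda>w u v. if u = v then 0 else w (min u v, max u v))"
  define \<phi> where "\<phi> = (\<lambda>x. sqrt (pmf g x / pmf f x))"
  have fg: "f = fp \<and> g = fm \<or> f = fm \<and> g = fp" by (auto simp: f_def g_def)
  have "E \<subseteq> {1..n} \<times> {1..n}" by (auto simp: E_def)
  then have finE: "finite E" by (rule finite_subset) simp
  have K': "set K \<subseteq> {1..n}" using K(1) cluster_subset[OF C] by blast
  have eE: "e ` set K \<subseteq> E"
  proof
    fix i assume "i \<in> e ` set K"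
    then obtain u where u: "u \<in> set K" "i = e u" by blast
    then have "u \<noteq> v" "u \<in> {1..n}" using K(2) K' by auto
    then show "i \<in> E" using u(2) v by (auto simp: e_def E_def min_def max_def)
  qed
  have inj: "inj_on e (set K)"
    by (auto simp: inj_on_def e_def min_def max_def split: if_splits)
  have pe: "p (e u) = f" if "u \<in> set K" for u
  proof -
    have u: "u \<in> C" "u \<in> {1..n}" using that K(1) K' by auto
    have "same_cluster P u v \<longleftrightarrow> v \<in> C"
    proof -
      have "cluster_of P u = C" using C u(1) by (rule cluster_of_eq)
      then show ?thesis by (auto simp: cluster_of_def)
    qed
    moreover have "same_cluster P v u \<longleftrightarrow> same_cluster P u v" by (auto simp: same_cluster_def)
    ultimately show ?thesis by (auto simp: p_def e_def f_def min_def max_def)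
  qed
  have hw: "h w u v = w (e u)" if "u \<in> set K" for w u
    using that K(2) by (auto simp: h_def e_def)
  have S: "set_pmf f = S" using fg set_pmf_eq by auto
  have err: "1 \<le> (\<Prod>u\<in>set K. \<phi> (w (e u)))"
    if w: "w \<in> set_pmf (Pi_pmf E 0 p)" and bad: "likelihood_test fp fm (h w) v K \<noteq> (v \<in> C)" for w
  proof -
    \<comment> \<open>Sampled values lie in \<open>S\<close>, where both masses are positive, so the
      logarithms are meaningful.\<close>
    have wS: "w (e u) \<in> S" if "u \<in> set K" for u
    proof -
      have "\<forall>i. i \<in> E \<longrightarrow> w i \<in> set_pmf (p i)"
        using w by (simp add: set_Pi_pmf[OF finE] PiE_dflt_def del: split_paired_All)
      then have "w (e u) \<in> set_pmf (p (e u))" using eE that by blast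
      then show ?thesis using pe[OF that] S by simp
    qed
    have gf: "0 < pmf g (w (e u)) / pmf f (w (e u))" if "u \<in> set K" for u
      using fg pos[OF wS[OF that]] by auto
    have "likelihood_test fp fm (h w) v K \<longleftrightarrow>
        0 < (\<Sum>u\<in>set K. ln (pmf fp (w (e u)) / pmf fm (w (e u))))"
      unfolding likelihood_test_def by (simp add: hw cong: sum.cong)
    moreover have "(\<Sum>u\<in>set K. ln (pmf fm (w (e u)) / pmf fp (w (e u))))
        = - (\<Sum>u\<in>set K. ln (pmf fp (w (e u)) / pmf fm (w (e u))))"
      unfolding sum_negf[symmetric] using pos[OF wS]
      by (intro sum.cong refl) (simp add: ln_div)
    ultimately have "0 \<le> (\<Sum>u\<in>set K. ln (pmf g (w (e u)) / pmf f (w (e u))))"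
      using bad by (auto simp: f_def g_def split: if_splits)
    then have "1 \<le> exp ((\<Sum>u\<in>set K. ln (pmf g (w (e u)) / pmf f (w (e u)))) / 2)" by simp
    also have "\<dots> = (\<Prod>u\<in>set K. exp (ln (pmf g (w (e u)) / pmf f (w (e u))) / 2))"
      by (simp add: sum_divide_distrib exp_sum)
    also have "\<dots> = (\<Prod>u\<in>set K. \<phi> (w (e u)))"
    proof (intro prod.cong refl)
      fix u assume "u \<in> set K"
      have "sqrt x = exp (ln x / 2)" if "0 < x" for x :: real
        using that by (simp add: powr_half_sqrt[symmetric] powr_def)
      then show "exp (ln (pmf g (w (e u)) / pmf f (w (e u))) / 2) = \<phi> (w (e u))"
        unfolding \<phi>_def using gf[OF \<open>u \<in> set K\<close>] by simp
    qed
    finally show ?thesis .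
  qed
  \<comment> \<open>The product formula runs over all of \<open>E\<close>; untested pairs get the
    factor 1.\<close>
  let ?F = "\<lambda>i. if i \<in> e ` set K then (\<lambda>x. ennreal (\<phi> x)) else (\<lambda>_. 1)"
  have prodE: "(\<Prod>i\<in>E. if i \<in> e ` set K then G i else 1) = (\<Prod>u\<in>set K. G (e u))"
    for G :: "nat \<times> nat \<Rightarrow> ennreal"
  proof -
    have "(\<Prod>i\<in>E. if i \<in> e ` set K then G i else 1) = (\<Prod>i\<in>e ` set K. G i)"
      using eE finE by (simp add: prod.inter_restrict[symmetric] Int_absorb1)
    then show ?thesis using inj by (simp add: prod.reindex)
  qed
  let ?bad = "{w. likelihood_test fp fm (h w) v K \<noteq> (v \<in> C)}"
  have "emeasure (Pi_pmf E 0 p) ?bad = (\<integral>\<^sup>+ w. indicator ?bad w \<partial>measure_pmf (Pi_pmf E 0 p))"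
    by simp
  \<comment> \<open>Markov's inequality, done pointwise under the integral.\<close>
  also have "\<dots> \<le> (\<integral>\<^sup>+ w. (\<Prod>i\<in>E. ?F i (w i)) \<partial>measure_pmf (Pi_pmf E 0 p))"
  proof (intro nn_integral_mono_AE AE_pmfI)
    fix w assume w: "w \<in> set_pmf (Pi_pmf E 0 p)"
    have "(\<Prod>i\<in>E. ?F i (w i)) = (\<Prod>i\<in>E. if i \<in> e ` set K then ennreal (\<phi> (w i)) else 1)"
      by (intro prod.cong) auto
    also have "\<dots> = (\<Prod>u\<in>set K. ennreal (\<phi> (w (e u))))" by (rule prodE)
    also have "\<dots> = ennreal (\<Prod>u\<in>set K. \<phi> (w (e u)))"
      by (rule prod_ennreal) (simp add: \<phi>_def)
    finally show "indicator ?bad w \<le> (\<Prod>i\<in>E. ?F i (w i))"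
      using err[OF w] by (auto simp: indicator_def)
  qed
  also have "\<dots> = (\<Prod>i\<in>E. \<integral>\<^sup>+ x. ?F i x \<partial>measure_pmf (p i))"
    by (rule nn_integral_prod_Pi_pmf[OF finE])
  also have "\<dots> = (\<Prod>i\<in>E. if i \<in> e ` set K then (\<integral>\<^sup>+ x. ennreal (\<phi> x) \<partial>measure_pmf (p i)) else 1)"
    by (intro prod.cong) auto
  also have "\<dots> = (\<Prod>u\<in>set K. \<integral>\<^sup>+ x. ennreal (\<phi> x) \<partial>measure_pmf (p (e u)))" by (rule prodE)
  also have "\<dots> = (\<Prod>u\<in>set K. ennreal affinity)"
    using nn_integral_sqrt_ratio[OF fg] by (intro prod.cong) (auto simp: pe \<phi>_def)
  also have "\<dots> = ennreal (affinity ^ length K)"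
    using affinity_nonneg K(3) by (simp add: distinct_card ennreal_power)
  finally have "measure_pmf.prob (Pi_pmf E 0 p) ?bad \<le> affinity ^ length K"
    using affinity_nonneg by (simp add: measure_pmf.emeasure_eq_measure)
  moreover have "side_info n P fp fm = map_pmf h (Pi_pmf E 0 p)"
    by (simp add: side_info_def h_def E_def p_def)
  ultimately show ?thesis by (simp add: vimage_def)
qed

lemma prob_tests_incorrect:
  "measure_pmf.prob (side_info n P fp fm) {W. \<not> tests_correct n P M (likelihood_test fp fm W)}
     \<le> real n ^ 2 * affinity ^ M"
proof -
  define I where "I = {(v, C). v \<in> {1..n} \<and> C \<in> P \<and>
    length (core n M C) = M \<and> v \<notin> set (core n M C)}"
  define A where "A = (\<lambda>(v, C). {W. likelihood_test fp fm W v (core n M C) \<noteq> (v \<in> C)})"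
  let ?pr = "measure_pmf.prob (side_info n P fp fm)"
  have sub: "I \<subseteq> {1..n} \<times> P" by (auto simp: I_def)
  have fin: "finite ({1..n} \<times> P)" using finite_clustering by simp
  have "card I \<le> card ({1..n} \<times> P)" by (rule card_mono[OF fin sub])
  also have "\<dots> = n * card P" by (simp add: card_cartesian_product)
  also have "\<dots> \<le> n ^ 2" using card_clustering_le by (simp add: power2_eq_square)
  finally have cardI: "real (card I) \<le> real n ^ 2" by (simp flip: of_nat_power)
  have "{W. \<not> tests_correct n P M (likelihood_test fp fm W)} = (\<Union>i\<in>I. A i)"
    unfolding tests_correct_def I_def A_def by blast
  then have "?pr {W. \<not> tests_correct n P M (likelihood_test fp fm W)} \<le> (\<Sum>i\<in>I. ?pr (A i))"
    using measure_pmf.finite_measure_subadditive_finite[OF finite_subset[OF sub fin], of A]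
    by simp
  also have "\<dots> \<le> (\<Sum>i\<in>I. affinity ^ M)"
  proof (rule sum_mono)
    fix i assume "i \<in> I"
    then obtain v C where i: "i = (v, C)" "v \<in> {1..n}" "C \<in> P"
      "length (core n M C) = M" "v \<notin> set (core n M C)" by (auto simp: I_def)
    have "set (core n M C) \<subseteq> C" "distinct (core n M C)"
      by (auto simp: core_def dest!: in_set_takeD simp del: upt_Suc)
    then show "?pr (A i) \<le> affinity ^ M"
      using prob_test_error[OF i(2,3), of "core n M C"] i by (simp add: A_def)
  qed
  also have "\<dots> = real (card I) * affinity ^ M" by simp
  also have "\<dots> \<le> real n ^ 2 * affinity ^ M"
    using cardI affinity_nonneg by (intro mult_right_mono) auto
  finally show ?thesis .
qed

subsection \<open>Query complexity\<close>

text \<open>For \<open>n = 1\<close> the logarithm vanishes and no such bound exists, so the query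
  bounds treat that case separately.\<close>

lemma sample_scale: "n \<ge> 2 \<Longrightarrow> 1 \<le> 2 / (\<epsilon> * ln 2) * (ln (real n) / sym_div fp fm)"
proof -
  assume "n \<ge> 2"
  then have "ln 2 \<le> ln (real n)" by simp
  then have "\<epsilon> * sym_div fp fm * ln 2 \<le> 2 * ln (real n)"
    using sym_div_le by (intro mult_mono) auto
  then show ?thesis using eps sym_div_pos by (simp add: field_simps)
qed

lemma core_size_le:
  assumes "n \<ge> 1" "d > 0"
  shows "real (core_size d \<epsilon> fp fm n) \<le> 8 * (d + 2) / \<epsilon> * (ln (real n) / sym_div fp fm) + 1"
proof -
  have "0 \<le> 8 * (d + 2) * ln (real n) / (\<epsilon> * sym_div fp fm)"
    using assms eps sym_div_pos by simp
  then have "real (nat \<lfloor>8 * (d + 2) * ln (real n) / (\<epsilon> * sym_div fp fm)\<rfloor>)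
      \<le> 8 * (d + 2) * ln (real n) / (\<epsilon> * sym_div fp fm)" by (rule of_nat_floor)
  then show ?thesis by (simp add: core_size_def)
qed

lemma prob_tests_incorrect_core_size:
  assumes n: "n \<ge> 1" and "d > 0"
  shows "measure_pmf.prob (side_info n P fp fm)
      {W. \<not> tests_correct n P (core_size d \<epsilon> fp fm n) (likelihood_test fp fm W)}
    \<le> real n powr (- d)"
proof -
  define M where "M = core_size d \<epsilon> fp fm n"
  have es: "0 < \<epsilon> * sym_div fp fm" using eps sym_div_pos by simp
  have "8 * (d + 2) * ln (real n) / (\<epsilon> * sym_div fp fm) \<le> real M"
    unfolding M_def core_size_def by linarith
  then have M: "(d + 2) * ln (real n) \<le> real M * (\<epsilon> * sym_div fp fm / 8)"
    using es by (simp add: field_simps)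
  have "affinity ^ M \<le> exp (- (\<epsilon> * sym_div fp fm / 8)) ^ M"
    by (intro power_mono affinity_le affinity_nonneg)
  also have "\<dots> = exp (- (real M * (\<epsilon> * sym_div fp fm / 8)))"
    by (simp add: exp_of_nat_mult[symmetric])
  also have "\<dots> \<le> exp (- ((d + 2) * ln (real n)))" using M by simp
  also have "\<dots> = real n powr (- d - 2)" using n by (simp add: powr_def algebra_simps)
  finally have "real n ^ 2 * affinity ^ M \<le> real n ^ 2 * real n powr (- d - 2)"
    by (intro mult_left_mono) auto
  also have "\<dots> = real n powr 2 * real n powr (- d - 2)" using n by (simp add: powr_numeral)
  also have "\<dots> = real n powr (- d)" by (subst powr_add[symmetric]) simp
  finally show ?thesis using prob_tests_incorrect[of M] by (simp add: M_def)
qed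

lemma seeded_initial: "seeded n P []"
  by (simp add: seeded_def)

lemma result_cluster_tree:
  assumes "n \<ge> 1" "b \<or> tests_correct n P (core_size d \<epsilon> fp fm n) (likelihood_test fp fm W)"
  shows "result P (cluster_tree b d \<epsilon> fp fm n W) = P"
  unfolding cluster_tree_def by (rule result_grow[OF tracks_initial]) (use assms in auto)

lemma prob_result_cluster_tree:
  assumes n: "n \<ge> 1" and "d > 0"
  shows "measure_pmf.prob (map_pmf (cluster_tree b d \<epsilon> fp fm n) (side_info n P fp fm))
      {t. result P t = P} \<ge> 1 - real n powr (- d)"
proof -
  let ?G = "{W. tests_correct n P (core_size d \<epsilon> fp fm n) (likelihood_test fp fm W)}"
  let ?pr = "measure_pmf.prob (side_info n P fp fm)"
  have "1 - real n powr (- d) \<le> 1 - ?pr (- ?G)"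
    using prob_tests_incorrect_core_size[OF assms] by (simp add: Collect_neg_eq)
  also have "\<dots> = ?pr ?G" using measure_pmf.prob_compl[of ?G "side_info n P fp fm"]
    by (simp add: Compl_eq_Diff_UNIV)
  also have "\<dots> \<le> ?pr {W. result P (cluster_tree b d \<epsilon> fp fm n W) = P}"
    by (rule measure_pmf.finite_measure_mono) (use result_cluster_tree[OF n] in auto)
  finally show ?thesis by (simp add: vimage_def)
qed

lemma num_queries_cluster_tree_unverified:
  assumes n: "n \<ge> 1" and d: "d > 0"
  shows "real (num_queries P (cluster_tree False d \<epsilon> fp fm n W))
    \<le> (8 * (d + 2) / \<epsilon> + 4 / (\<epsilon> * ln 2)) * (real (card P) ^ 2 * ln (real n) / sym_div fp fm)"
proof (cases "n = 1")
  \<comment> \<open>The claimed bound is 0 here, and a single vertex indeed needs no query.\<close>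
  case True
  then have "num_queries P (cluster_tree False d \<epsilon> fp fm n W) = 0"
    by (simp add: cluster_tree_def)
  then show ?thesis using True by simp
next
  case False
  let ?k = "real (card P)" and ?x = "ln (real n) / sym_div fp fm"
  define M where "M = core_size d \<epsilon> fp fm n"
  have M: "0 < M" by (simp add: M_def core_size_def)
  have "num_queries P (cluster_tree False d \<epsilon> fp fm n W) \<le> card P * (card P * M + 1)"
    using num_queries_grow_unverified[OF seeded_initial _ M] unfolding cluster_tree_def M_def[symmetric]
    by (metis (no_types, lifting) add_leD1 atLeastLessThanSuc_atLeastAtMost set_upt subset_refl)
  also have "\<dots> \<le> card P ^ 2 * M + card P ^ 2"
    by (simp add: power2_eq_square algebra_simps)
  finally have "real (num_queries P (cluster_tree False d \<epsilon> fp fm n W)) \<le> real (card P ^ 2 * M + card P ^ 2)"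
    by (rule of_nat_mono)
  also have "\<dots> = ?k\<^sup>2 * (real M + 1)" by (simp add: algebra_simps)
  also have "\<dots> \<le> ?k\<^sup>2 * ((8 * (d + 2) / \<epsilon> + 4 / (\<epsilon> * ln 2)) * ?x)"
  proof (rule mult_left_mono)
    \<comment> \<open>One unit comes from rounding in \<open>core_size\<close>, the other from the
      round that may end in an abort.\<close>
    have "real M + 1 \<le> 8 * (d + 2) / \<epsilon> * ?x + 2 * 1"
      using core_size_le[OF n d] by (simp add: M_def)
    also have "\<dots> \<le> 8 * (d + 2) / \<epsilon> * ?x + 2 * (2 / (\<epsilon> * ln 2) * ?x)"
      using sample_scale False n by (intro add_left_mono mult_left_mono) auto
    finally show "real M + 1 \<le> (8 * (d + 2) / \<epsilon> + 4 / (\<epsilon> * ln 2)) * ?x"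
      by (simp add: distrib_right del: times_divide_eq_right times_divide_eq_left)
  qed simp
  finally show ?thesis by (simp add: mult_ac)
qed

text \<open>With \<open>d = 1\<close> the crude bound \<open>(card P + 1) * n\<close> is weighted by
  at most \<open>1 / n\<close>. In \<open>4 * n\<close>, one \<open>n\<close> is for confirmations,
  two for test errors, and one for rounding when \<open>n = 1\<close>.\<close>

lemma expected_num_queries_cluster_tree_verified:
  assumes n: "n \<ge> 1"
  shows "(\<integral>\<^sup>+ W. ennreal (real (num_queries P (cluster_tree True 1 \<epsilon> fp fm n W)))
      \<partial>measure_pmf (side_info n P fp fm))
    \<le> ennreal (4 * real n
        + (24 / \<epsilon> + 2 / (\<epsilon> * ln 2)) * (real (card P) ^ 2 * ln (real n) / sym_div fp fm))"
proof -
  let ?k = "real (card P)" and ?x = "ln (real n) / sym_div fp fm"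
  let ?q = "\<lambda>W. num_queries P (cluster_tree True 1 \<epsilon> fp fm n W)"
  define M where "M = core_size 1 \<epsilon> fp fm n"
  define Bad where "Bad = {W. \<not> tests_correct n P M (likelihood_test fp fm W)}"
  have M: "0 < M" by (simp add: M_def core_size_def)
  have x: "0 \<le> ?x" using n sym_div_pos by simp
  have k: "?k \<le> real n" using card_clustering_le by simp
  have good: "?q W \<le> n + card P ^ 2 * M" if "W \<notin> Bad" for W
  proof -
    have "tests_correct n P M (likelihood_test fp fm W)" using that by (simp add: Bad_def)
    from num_queries_grow_verified[OF seeded_initial tracks_initial _ _ refl this M]
    have "?q W + card P * filled M [] \<le> length [1..<Suc n] + card P * (card P * M)"
      unfolding cluster_tree_def M_def by simp
    then show ?thesis by (simp add: power2_eq_square mult.assoc del: upt_Suc)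
  qed
  have bad: "?q W \<le> (card P + 1) * n" for W
    using num_queries_grow_verified_le[OF seeded_initial, of "[1..<Suc n]"]
    unfolding cluster_tree_def by (simp add: atLeastLessThanSuc_atLeastAtMost del: upt_Suc)
  have "(\<integral>\<^sup>+ W. ennreal (real (?q W)) \<partial>measure_pmf (side_info n P fp fm))
      \<le> (\<integral>\<^sup>+ W. ennreal (real (n + card P ^ 2 * M)) + ennreal (real ((card P + 1) * n)) * indicator Bad W
          \<partial>measure_pmf (side_info n P fp fm))"
  proof (rule nn_integral_mono)
    fix W
    show "ennreal (real (?q W))
        \<le> ennreal (real (n + card P ^ 2 * M)) + ennreal (real ((card P + 1) * n)) * indicator Bad W"
    proof (cases "W \<in> Bad")
      case True
      have "ennreal (real (?q W)) \<le> ennreal (real ((card P + 1) * n))"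
        using bad[of W] by (intro ennreal_leI of_nat_mono)
      then show ?thesis using True by (simp add: add_increasing)
    next
      case False
      have "ennreal (real (?q W)) \<le> ennreal (real (n + card P ^ 2 * M))"
        using good[OF False] by (intro ennreal_leI of_nat_mono)
      then show ?thesis using False by simp
    qed
  qed
  also have "\<dots> = ennreal (real (n + card P ^ 2 * M))
      + ennreal (real ((card P + 1) * n)) * emeasure (side_info n P fp fm) Bad"
    by (simp add: nn_integral_add nn_integral_cmult measure_pmf.emeasure_space_1)
  also have "\<dots> = ennreal (real (n + card P ^ 2 * M)
      + real ((card P + 1) * n) * measure_pmf.prob (side_info n P fp fm) Bad)"
    by (simp add: measure_pmf.emeasure_eq_measure ennreal_mult[symmetric] ennreal_plus[symmetric] del: ennreal_plus)
  also have "\<dots> \<le> ennreal (4 * real n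
      + (24 / \<epsilon> + 2 / (\<epsilon> * ln 2)) * (real (card P) ^ 2 * ln (real n) / sym_div fp fm))"
  proof (rule ennreal_leI)
    have "real ((card P + 1) * n) * measure_pmf.prob (side_info n P fp fm) Bad
        \<le> real ((card P + 1) * n) * real n powr (- 1)"
      using prob_tests_incorrect_core_size[OF n, of 1] by (intro mult_left_mono) (auto simp: Bad_def M_def)
    also have "\<dots> = ?k + 1" using n by (simp add: powr_minus field_simps)
    finally have 1: "real ((card P + 1) * n) * measure_pmf.prob (side_info n P fp fm) Bad \<le> 2 * real n"
      using k n by simp
    \<comment> \<open>This absorbs the rounding of the core size: into \<open>n\<close> if
      \<open>n = 1\<close>, where \<open>card P \<le> 1\<close>, and otherwise into the logarithmic
      term.\<close>
    have 2: "?k\<^sup>2 \<le> real n + ?k\<^sup>2 * (2 / (\<epsilon> * ln 2) * ?x)"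
    proof (cases "n = 1")
      case True
      then have "?k\<^sup>2 \<le> 1" using k by (simp add: power_le_one)
      then show ?thesis using True by simp
    next
      case False
      then have "?k\<^sup>2 * 1 \<le> ?k\<^sup>2 * (2 / (\<epsilon> * ln 2) * ?x)"
        using sample_scale n by (intro mult_left_mono) auto
      then show ?thesis by simp
    qed
    have "?k\<^sup>2 * real M \<le> ?k\<^sup>2 * (24 / \<epsilon> * ?x + 1)"
      using core_size_le[OF n, of 1] by (intro mult_left_mono) (auto simp: M_def)
    then have "?k\<^sup>2 * real M \<le> ?k\<^sup>2 * (24 / \<epsilon> * ?x) + ?k\<^sup>2" by (simp add: distrib_left)
    with 1 2 have "real (n + card P ^ 2 * M)
        + real ((card P + 1) * n) * measure_pmf.prob (side_info n P fp fm) Bad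
      \<le> 4 * real n + (?k\<^sup>2 * (24 / \<epsilon> * ?x) + ?k\<^sup>2 * (2 / (\<epsilon> * ln 2) * ?x))"
      by simp
    also have "?k\<^sup>2 * (24 / \<epsilon> * ?x) + ?k\<^sup>2 * (2 / (\<epsilon> * ln 2) * ?x)
        = (24 / \<epsilon> + 2 / (\<epsilon> * ln 2)) * (?k\<^sup>2 * ln (real n) / sym_div fp fm)"
      unfolding times_divide_eq_right[symmetric, of "?k\<^sup>2"] by (simp only: algebra_simps)
    finally show "real (n + card P ^ 2 * M)
        + real ((card P + 1) * n) * measure_pmf.prob (side_info n P fp fm) Bad
      \<le> 4 * real n + (24 / \<epsilon> + 2 / (\<epsilon> * ln 2)) * (?k\<^sup>2 * ln (real n) / sym_div fp fm)" .
  qed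
  finally show ?thesis .
qed

end

lemma query_alg_cluster_tree: "query_alg (\<lambda>n W. return_pmf (cluster_tree b d \<epsilon> fp fm n W))"
  unfolding query_alg_def cluster_tree_def by (auto intro!: valid_queries_grow simp del: upt_Suc)

lemma execution_deterministic:
  "execution (\<lambda>n W. return_pmf (f n W)) fp fm n P = map_pmf (f n) (side_info n P fp fm)"
  by (simp add: execution_def map_pmf_def)

text \<open>\<open>C\<close> is chosen before the distributions and depends on
  \<open>\<epsilon>\<close> and \<open>d\<close> only. The Monte Carlo bound holds on every run, and
  \<open>fp \<noteq> fm\<close> makes the divisor positive.\<close>

theorem theorem11:
  fixes \<epsilon> d :: real
  assumes "\<epsilon> > 0" and "d > 0"
  shows "\<exists>C>0. \<forall>(S :: real set) fp fm.
    finite S \<and> S \<subseteq> {0..1} \<and> set_pmf fp \<subseteq> S \<and> set_pmf fm \<subseteq> S \<and>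
    (\<forall>x\<in>S. pmf fp x \<ge> \<epsilon>) \<and> (\<forall>x\<in>S. pmf fm x \<ge> \<epsilon>) \<and> fp \<noteq> fm \<longrightarrow>
    (\<exists>A. monte_carlo d fp fm A \<and>
       (\<forall>n\<ge>1. \<forall>P. partition_on {1..n} P \<longrightarrow>
          (\<forall>t\<in>set_pmf (execution A fp fm n P).
             real (num_queries P t) \<le> C * (real (card P) ^ 2 * ln (real n) / sym_div fp fm)))) \<and>
    (\<exists>B. las_vegas fp fm B \<and>
       (\<forall>n\<ge>1. \<forall>P. partition_on {1..n} P \<longrightarrow>
          (\<integral>\<^sup>+ t. ennreal (real (num_queries P t)) \<partial>measure_pmf (execution B fp fm n P))
            \<le> ennreal (C * (real n + real (card P) ^ 2 * ln (real n) / sym_div fp fm))))"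
proof -
  \<comment> \<open>The sum of nonnegative terms dominates each coefficient of the two query
    bounds.\<close>
  define C where "C = 4 + 8 * (d + 2) / \<epsilon> + 24 / \<epsilon> + 4 / (\<epsilon> * ln 2)"
  have terms: "0 \<le> 8 * (d + 2) / \<epsilon>" "0 \<le> 24 / \<epsilon>" "0 \<le> 2 / (\<epsilon> * ln 2)"
    "4 / (\<epsilon> * ln 2) = 2 * (2 / (\<epsilon> * ln 2))"
    using assms by simp_all
  have C: "0 < C" "4 \<le> C" "8 * (d + 2) / \<epsilon> + 4 / (\<epsilon> * ln 2) \<le> C" "24 / \<epsilon> + 2 / (\<epsilon> * ln 2) \<le> C"
    unfolding C_def using terms by linarith+
  show ?thesis
  proof (intro exI[of _ C] conjI allI impI C(1))
    fix S :: "real set" and fp fm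
    assume *: "finite S \<and> S \<subseteq> {0..1} \<and> set_pmf fp \<subseteq> S \<and> set_pmf fm \<subseteq> S \<and>
      (\<forall>x\<in>S. pmf fp x \<ge> \<epsilon>) \<and> (\<forall>x\<in>S. pmf fm x \<ge> \<epsilon>) \<and> fp \<noteq> fm"
    have si: "side_information n P S fp fm \<epsilon>" if "partition_on {1..n} P" for n P
      using that * assms(1) by unfold_locales auto
    let ?alg = "\<lambda>b d n W. return_pmf (cluster_tree b d \<epsilon> fp fm n W)"
    have cost: "0 \<le> real (card P) ^ 2 * ln (real n) / sym_div fp fm"
      if "n \<ge> 1" "partition_on {1..n} P" for n P
    proof -
      interpret side_information n P S fp fm \<epsilon> using si[OF that(2)] .
      show ?thesis using sym_div_pos that(1) by simp
    qed
    show "\<exists>A. monte_carlo d fp fm A \<and>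
       (\<forall>n\<ge>1. \<forall>P. partition_on {1..n} P \<longrightarrow>
          (\<forall>t\<in>set_pmf (execution A fp fm n P).
             real (num_queries P t) \<le> C * (real (card P) ^ 2 * ln (real n) / sym_div fp fm)))"
    proof (intro exI[of _ "?alg False d"] conjI allI impI ballI)
      show "monte_carlo d fp fm (?alg False d)"
        unfolding monte_carlo_def execution_deterministic
        using query_alg_cluster_tree side_information.prob_result_cluster_tree[OF si _ assms(2)]
        by blast
    next
      fix n :: nat and P t
      assume n: "1 \<le> n" and P: "partition_on {1..n} P" and "t \<in> set_pmf (execution (?alg False d) fp fm n P)"
      then obtain W where t: "t = cluster_tree False d \<epsilon> fp fm n W"
        unfolding execution_deterministic by auto
      show "real (num_queries P t) \<le> C * (real (card P) ^ 2 * ln (real n) / sym_div fp fm)"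
        unfolding t
        using side_information.num_queries_cluster_tree_unverified[OF si[OF P] n assms(2), of W]
          mult_right_mono[OF C(3) cost[OF n P]] by linarith
    qed
    show "\<exists>B. las_vegas fp fm B \<and>
       (\<forall>n\<ge>1. \<forall>P. partition_on {1..n} P \<longrightarrow>
          (\<integral>\<^sup>+ t. ennreal (real (num_queries P t)) \<partial>measure_pmf (execution B fp fm n P))
            \<le> ennreal (C * (real n + real (card P) ^ 2 * ln (real n) / sym_div fp fm)))"
    \<comment> \<open>The Las Vegas version uses exponent 1 regardless of \<open>d\<close>: failure
      probability \<open>1 / n\<close> already offsets the worst-case cost.\<close>
    proof (intro exI[of _ "?alg True 1"] conjI allI impI)
      show "las_vegas fp fm (?alg True 1)"
        unfolding las_vegas_def execution_deterministic
        using query_alg_cluster_tree side_information.result_cluster_tree[OF si] by auto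
    next
      fix n :: nat and P
      assume n: "1 \<le> n" and P: "partition_on {1..n} P"
      let ?y = "real (card P) ^ 2 * ln (real n) / sym_div fp fm"
      have "(\<integral>\<^sup>+ t. ennreal (real (num_queries P t)) \<partial>measure_pmf (execution (?alg True 1) fp fm n P))
          \<le> ennreal (4 * real n + (24 / \<epsilon> + 2 / (\<epsilon> * ln 2)) * ?y)"
        using side_information.expected_num_queries_cluster_tree_verified[OF si[OF P] n]
        by (simp add: execution_deterministic)
      also have "\<dots> \<le> ennreal (C * (real n + ?y))"
        using mult_right_mono[OF C(4) cost[OF n P]] mult_right_mono[OF C(2), of "real n"]
        by (intro ennreal_leI) (simp add: distrib_left)
      finally show "(\<integral>\<^sup>+ t. ennreal (real (num_queries P t)) \<partial>measure_pmf (execution (?alg True 1) fp fm n P))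
          \<le> ennreal (C * (real n + ?y))" .
    qed
  qed
qed

end
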